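(* Let $\phi: B_a\to\mathbb{R}^N$ be a homeomorphism from $B_a$ onto $\mathbb{R}^N$ with $\phi(0)=0$ and $\phi=\nabla\Phi$ on $B_a$, where $\Phi:\overline{B}_a\to\mathbb{R}$ is of class $C^1$ on $B_a$, continuous and strictly convex on $\overline{B}_a$, and $\Phi(0)=0$. Let $\gamma:\mathbb{R}^N\times\mathbb{R}^N\to 2^{\mathbb{R}^N\times\mathbb{R}^N}$ be a maximal monotone operator with $(0,0)\in\gamma(0,0)$. Then, for any $h:\mathbb{Z}[1,T]\to\mathbb{R}^N$, the problem $$\begin{cases}-\Delta[\phi(\Delta u(n-1))]+u(n)=h(n) & (n\in\mathbb{Z}[1,T]),\\ (\phi(\Delta u(0)),-\phi(\Delta u(T)))\in\gamma(u(0),u(T+1))\end{cases}$$ has a unique solution $u_h:\mathbb{Z}[0,T+1]\to\mathbb{R}^N$.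
   Context: $N\ge 1$ and $T\ge 2$ are fixed integers and $a>0$ is fixed. $\langle\cdot|\cdot\rangle$ and $|\cdot|$ are the Euclidean inner product and norm on $\mathbb{R}^N$, and $\mathbb{R}^N\times\mathbb{R}^N$ carries its usual inner product (monotonicity is understood with respect to it). $B_a=\{x\in\mathbb{R}^N:|x|<a\}$. $\mathbb{Z}[p,q]=\{p,p+1,\dots,q\}$. For $u:\mathbb{Z}[0,T+1]\to\mathbb{R}^N$: $\Delta u(n-1)=u(n)-u(n-1)$, $\Delta[\phi(\Delta u(n-1))]=\phi(\Delta u(n))-\phi(\Delta u(n-1))$, and $\|\Delta u\|_\infty=\max_{n\in\mathbb{Z}[1,T+1]}|\Delta u(n-1)|$. The domain of $\gamma$ is $D(\gamma)=\{z:\gamma(z)\ne\emptyset\}$. A solution of the problem is a function $u:\mathbb{Z}[0,T+1]\to\mathbb{R}^N$ with $\|\Delta u\|_\infty<a$ and $(u(0),u(T+1))\in D(\gamma)$ that satisfies both the equations and the boundary condition. *)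

theory Defs
  imports "HOL-Analysis.Analysis"
begin

(* Intended for open S: the derivative is the full one, not the one within S. *)
definition C1_on :: "'a::real_normed_vector set \<Rightarrow> ('a \<Rightarrow> 'b::real_normed_vector) \<Rightarrow> bool" where
  "C1_on S f \<longleftrightarrow>
    (\<exists>f' :: 'a \<Rightarrow> 'a \<Rightarrow>\<^sub>L 'b. (\<forall>x\<in>S. (f has_derivative blinfun_apply (f' x)) (at x)) \<and> continuous_on S f')"

definition strictly_convex_on :: "'a::real_vector set \<Rightarrow> ('a \<Rightarrow> real) \<Rightarrow> bool" where
  "strictly_convex_on S f \<longleftrightarrow> convex S \<and>
    (\<forall>x\<in>S. \<forall>y\<in>S. \<forall>s>0. \<forall>t>0. x \<noteq> y \<and> s + t = 1 \<longrightarrow>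
      f (s *\<^sub>R x + t *\<^sub>R y) < s * f x + t * f y)"

definition op_domain :: "('a \<Rightarrow> 'b set) \<Rightarrow> 'a set" where
  "op_domain A = {x. A x \<noteq> {}}"

definition monotone_operator :: "('a::real_inner \<Rightarrow> 'a set) \<Rightarrow> bool" where
  "monotone_operator A \<longleftrightarrow> (\<forall>x y. \<forall>p\<in>A x. \<forall>q\<in>A y. 0 \<le> inner (p - q) (x - y))"

definition maximal_monotone :: "('a::real_inner \<Rightarrow> 'a set) \<Rightarrow> bool" where
  "maximal_monotone A \<longleftrightarrow> monotone_operator A \<and>
    (\<forall>B. monotone_operator B \<and> (\<forall>x. A x \<subseteq> B x) \<longrightarrow> B = A)"

definition fwd_diff :: "(nat \<Rightarrow> 'a::ab_group_add) \<Rightarrow> nat \<Rightarrow> 'a" where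
  "fwd_diff u n = u (n + 1) - u n"

definition fwd_diff_sup_norm :: "nat \<Rightarrow> (nat \<Rightarrow> 'a::real_normed_vector) \<Rightarrow> real" where
  "fwd_diff_sup_norm T u = Max ((\<lambda>n. norm (fwd_diff u (n - 1))) ` {1..T+1})"

(* Only the values of u on {0..T+1}, of h on {1..T} and of \<phi> on the open ball of radius a
   matter here. *)
definition is_solution ::
  "real \<Rightarrow> ('a::real_inner \<Rightarrow> 'a) \<Rightarrow> ('a \<times> 'a \<Rightarrow> ('a \<times> 'a) set) \<Rightarrow> nat \<Rightarrow> (nat \<Rightarrow> 'a) \<Rightarrow> (nat \<Rightarrow> 'a) \<Rightarrow> bool"
where
  "is_solution a \<phi> \<gamma> T h u \<longleftrightarrow>
    fwd_diff_sup_norm T u < a \<and>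
    (u 0, u (T + 1)) \<in> op_domain \<gamma> \<and>
    (\<forall>n\<in>{1..T}. - fwd_diff (\<lambda>k. \<phi> (fwd_diff u k)) (n - 1) + u n = h n) \<and>
    (\<phi> (fwd_diff u 0), - \<phi> (fwd_diff u T)) \<in> \<gamma> (u 0, u (T + 1))"

end

theory Submission
  imports Defs
begin

text \<open>
  Write \<open>p n = \<phi> (u (n + 1) - u n)\<close> for the flux and \<open>\<psi>\<close> for the inverse of \<open>\<phi>\<close>, a bounded,
  continuous, monotone map defined on the whole space. The difference equation is the explicit
  recursion \<open>u (n + 1) = u n + \<psi> (p n)\<close>, \<open>p (n + 1) = p n + u (n + 1) - h (n + 1)\<close>, so every solution
  of it is determined by the initial state \<open>s = (u 0, p 0)\<close>. It remains to choose \<open>s\<close> such that the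
  boundary flux \<open>J s = (p 0, - p T)\<close> belongs to \<open>\<gamma>\<close> of the boundary value \<open>V s = (u 0, u (T + 1))\<close>.

  Summation by parts (\<open>inner_summation_by_parts\<close>) expresses \<open>- \<langle>V s, J s\<rangle>\<close>, and likewise
  \<open>- \<langle>V s - V s', J s - J s'\<rangle>\<close>, as a sum of interior terms, which monotonicity of \<open>\<psi>\<close> controls.
  Three consequences are drawn from this.
  \<^item> \<open>J\<close> is injective and preimages of bounded sets are bounded. By invariance of domain, \<open>J\<close> is a
    homeomorphism of the whole space, and the boundary value becomes a continuous function
    \<open>K = V \<circ> J\<inverse>\<close> of the boundary flux.
  \<^item> \<open>\<langle>K w, w\<rangle> \<ge> 0\<close> only for \<open>w\<close> in a bounded set, because \<open>\<langle>\<psi> p, p\<rangle>\<close> grows at least linearly in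
    \<open>norm p\<close>.
  \<^item> Two solutions agree on \<open>{1..T}\<close>, since monotonicity of \<open>\<gamma>\<close> makes the boundary pairing of their
    difference nonnegative. As \<open>T \<ge> 2\<close>, this determines one flux, then by the equation all fluxes,
    and hence the values at \<open>0\<close> and \<open>T + 1\<close>.

  Existence is thereby reduced to the inclusion \<open>w \<in> \<gamma> (K w)\<close>. The finite form of the
  Debrunner--Flor theorem (\<open>debrunner_flor_finite\<close>), a consequence of Brouwer's fixed point theorem,
  gives for each finite part of the graph of \<open>\<gamma>\<close> a point \<open>w\<close> whose pair \<open>(K w, w)\<close> is monotonically
  related to it. The bound on \<open>w\<close> and compactness give one \<open>w\<close> for the entire graph, and maximality
  of \<open>\<gamma>\<close> puts \<open>(K w, w)\<close> into the graph (\<open>maximal_monotone_inclusion_solvable\<close>).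
\<close>

section \<open>Inclusions with a maximal monotone operator\<close>

lemma weighted_monotone_sum_nonneg:
  fixes F :: "('a::real_inner \<times> 'a) set" and c :: "'a \<times> 'a \<Rightarrow> real"
  assumes mono: "\<And>z z'. z \<in> F \<Longrightarrow> z' \<in> F \<Longrightarrow> 0 \<le> inner (snd z - snd z') (fst z - fst z')"
    and c: "\<And>z. z \<in> F \<Longrightarrow> 0 \<le> c z"
  shows "0 \<le> (\<Sum>z\<in>F. c z * inner (snd z) (sum c F *\<^sub>R fst z - (\<Sum>z'\<in>F. c z' *\<^sub>R fst z')))"
    (is "0 \<le> ?E")
proof -
  have E: "?E = (\<Sum>z\<in>F. \<Sum>z'\<in>F. c z * c z' * inner (snd z) (fst z - fst z'))"
  proof (rule sum.cong [OF refl])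
    fix z assume "z \<in> F"
    have "sum c F *\<^sub>R fst z - (\<Sum>z'\<in>F. c z' *\<^sub>R fst z') = (\<Sum>z'\<in>F. c z' *\<^sub>R (fst z - fst z'))"
      by (simp add: scaleR_sum_left scaleR_diff_right sum_subtractf)
    then show "c z * inner (snd z) (sum c F *\<^sub>R fst z - (\<Sum>z'\<in>F. c z' *\<^sub>R fst z'))
        = (\<Sum>z'\<in>F. c z * c z' * inner (snd z) (fst z - fst z'))"
      by (simp add: inner_sum_right sum_distrib_left mult.assoc)
  qed
  have E': "?E = (\<Sum>z\<in>F. \<Sum>z'\<in>F. c z * c z' * inner (snd z') (fst z' - fst z))"
    unfolding E by (subst sum.swap) (simp add: mult.commute)
  have "?E + ?E = (\<Sum>z\<in>F. \<Sum>z'\<in>F. c z * c z' * inner (snd z - snd z') (fst z - fst z'))"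
    by (subst E, subst E')
      (simp add: sum.distrib [symmetric] inner_diff_left inner_diff_right algebra_simps)
  also have "\<dots> \<ge> 0"
    by (intro sum_nonneg mult_nonneg_nonneg mono c)
  finally show ?thesis by simp
qed

text \<open>
  The points of \<open>F\<close> are pairs \<open>(x, y)\<close> of a graph. If no \<open>w\<close> were admissible, every \<open>w\<close> would violate
  at least one inequality; averaging the points \<open>x\<close> with weights that measure the violation
  defines a continuous self-map of the convex hull, and monotonicity contradicts the strict
  inequalities at a fixed point of this map.
\<close>
lemma debrunner_flor_finite:
  fixes F :: "('a::euclidean_space \<times> 'a) set" and B :: "'a \<Rightarrow> 'a"
  assumes F: "finite F" "F \<noteq> {}"
    and mono: "\<And>z z'. z \<in> F \<Longrightarrow> z' \<in> F \<Longrightarrow> 0 \<le> inner (snd z - snd z') (fst z - fst z')"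
    and B: "continuous_on UNIV B"
  shows "\<exists>w. \<forall>z\<in>F. 0 \<le> inner (snd z + B w) (fst z - w)"
proof (rule ccontr)
  assume neg: "\<nexists>w. \<forall>z\<in>F. 0 \<le> inner (snd z + B w) (fst z - w)"
  define c where "c z w = max 0 (- inner (snd z + B w) (fst z - w))" for z w
  define C where "C w = (\<Sum>z\<in>F. c z w)" for w
  define f where "f w = (\<Sum>z\<in>F. (c z w / C w) *\<^sub>R fst z)" for w
  let ?S = "convex hull (fst ` F)"
  have c0: "0 \<le> c z w" for z w by (simp add: c_def)
  have Cpos: "0 < C w" for w
  proof -
    obtain z where "z \<in> F" "inner (snd z + B w) (fst z - w) < 0"
      using neg by (meson not_le)
    then show ?thesis
      unfolding C_def using F c0 by (intro sum_pos2 [of F z]) (auto simp: c_def)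
  qed
  have contc: "continuous_on ?S (c z)" for z
    unfolding c_def using continuous_on_subset [OF B]
    by (intro continuous_intros) auto
  have "continuous_on ?S f"
    unfolding f_def C_def using contc Cpos
    by (intro continuous_intros) (auto simp: C_def less_le)
  moreover have "f \<in> ?S \<rightarrow> ?S"
  proof
    fix w
    show "f w \<in> ?S"
      unfolding f_def
    proof (rule convex_sum)
      show "(\<Sum>z\<in>F. c z w / C w) = 1"
        using Cpos [of w] by (simp add: sum_divide_distrib [symmetric] C_def)
    qed (use F Cpos c0 in \<open>auto simp: less_imp_le hull_inc\<close>)
  qed
  moreover have "compact ?S" "?S \<noteq> {}"
    using F by (auto simp: finite_imp_compact_convex_hull)
  ultimately obtain w where w: "f w = w"
    using brouwer [of ?S f] by auto
  have Cw: "C w *\<^sub>R w = (\<Sum>z\<in>F. c z w *\<^sub>R fst z)"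
  proof -
    have "C w *\<^sub>R f w = (\<Sum>z\<in>F. c z w *\<^sub>R fst z)"
      unfolding f_def scaleR_sum_right using Cpos [of w] by simp
    then show ?thesis by (simp add: w)
  qed
  \<comment> \<open>at the fixed point the terms containing \<open>B w\<close> cancel\<close>
  have "(\<Sum>z\<in>F. c z w * inner (B w) (fst z - w))
      = inner (B w) ((\<Sum>z\<in>F. c z w *\<^sub>R fst z) - C w *\<^sub>R w)"
    by (simp add: C_def inner_diff_right inner_sum_right sum_subtractf sum_distrib_right
        right_diff_distrib)
  then have Bz: "(\<Sum>z\<in>F. c z w * inner (B w) (fst z - w)) = 0"
    by (simp add: Cw)
  have "0 \<le> (\<Sum>z\<in>F. c z w * inner (snd z) (C w *\<^sub>R fst z - C w *\<^sub>R w))"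
    using weighted_monotone_sum_nonneg [of F "\<lambda>z. c z w"] mono c0
    by (simp add: Cw flip: C_def)
  also have "\<dots> = C w * (\<Sum>z\<in>F. c z w * inner (snd z) (fst z - w))"
    by (simp add: sum_distrib_left mult.left_commute flip: scaleR_diff_right)
  finally have "0 \<le> (\<Sum>z\<in>F. c z w * inner (snd z) (fst z - w))"
    using Cpos [of w] by (simp add: zero_le_mult_iff)
  with Bz have ge: "0 \<le> (\<Sum>z\<in>F. c z w * inner (snd z + B w) (fst z - w))"
    by (simp add: inner_add_left distrib_left sum.distrib)
  have "(\<Sum>z\<in>F. c z w * inner (snd z + B w) (fst z - w)) = - (\<Sum>z\<in>F. (c z w)\<^sup>2)"
    unfolding sum_negf [symmetric]
    by (intro sum.cong) (auto simp: c_def max_def power2_eq_square)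
  with ge have "(\<Sum>z\<in>F. (c z w)\<^sup>2) = 0"
    using sum_nonneg [of F "\<lambda>z. (c z w)\<^sup>2"] by simp
  then have "C w = 0"
    unfolding C_def using F by (simp add: sum_nonneg_eq_0_iff)
  with Cpos [of w] show False by simp
qed

lemma maximal_monotone_mem:
  assumes max: "maximal_monotone A"
    and rel: "\<And>x q. q \<in> A x \<Longrightarrow> 0 \<le> inner (q - w) (x - z)"
  shows "w \<in> A z"
proof -
  define B where "B = A(z := insert w (A z))"
  have mono: "0 \<le> inner (p - q) (x - y)" if "p \<in> A x" "q \<in> A y" for p q x y
    using max that unfolding maximal_monotone_def monotone_operator_def by blast
  have rel': "0 \<le> inner (w - q) (z - x)" if "q \<in> A x" for q x
    using rel [OF that] by (metis inner_minus_left inner_minus_right minus_diff_eq)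
  have "monotone_operator B"
    unfolding monotone_operator_def B_def
    using mono rel rel' by (auto split: if_splits)
  moreover have "\<forall>x. A x \<subseteq> B x" by (auto simp: B_def)
  ultimately have "B = A" using max unfolding maximal_monotone_def by blast
  then show ?thesis unfolding B_def by (metis fun_upd_same insertI1)
qed

text \<open>
  No monotonicity of \<open>K\<close> is needed. The pair \<open>(0, 0)\<close> of the graph is included in each finite
  part, where its inequality is \<open>\<langle>K w, w\<rangle> \<ge> 0\<close> and confines \<open>w\<close> to a fixed ball.
\<close>
lemma maximal_monotone_inclusion_solvable:
  fixes \<gamma> :: "'a::euclidean_space \<Rightarrow> 'a set" and K :: "'a \<Rightarrow> 'a"
  assumes max: "maximal_monotone \<gamma>" and zero: "0 \<in> \<gamma> 0"
    and K: "continuous_on UNIV K"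
    and coercive: "\<And>w. 0 \<le> inner (K w) w \<Longrightarrow> norm w \<le> R"
  shows "\<exists>w. w \<in> \<gamma> (K w)"
proof -
  \<comment> \<open>\<open>G\<close> is the graph of the inverse of \<open>\<gamma>\<close>\<close>
  define G where "G = {z. fst z \<in> \<gamma> (snd z)}"
  define S where "S z = {w. 0 \<le> inner (snd z - K w) (fst z - w)}" for z
  have mono: "0 \<le> inner (snd z - snd z') (fst z - fst z')" if "z \<in> G" "z' \<in> G" for z z'
  proof -
    have "0 \<le> inner (fst z - fst z') (snd z - snd z')"
      using max that unfolding maximal_monotone_def monotone_operator_def G_def by blast
    then show ?thesis by (simp add: inner_commute)
  qed
  have "cball 0 R \<inter> (\<Inter>z\<in>G. S z) \<noteq> {}"
  proof (rule compact_imp_fip_image)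
    show "closed (S z)" for z
      unfolding S_def by (intro closed_Collect_le continuous_intros K)
  next
    fix F assume F: "finite F" "F \<subseteq> G"
    have "\<exists>w. \<forall>z\<in>insert (0, 0) F. 0 \<le> inner (snd z + - K w) (fst z - w)"
    proof (rule debrunner_flor_finite)
      show "continuous_on UNIV (\<lambda>w. - K w)" by (intro continuous_intros K)
      have "insert (0, 0) F \<subseteq> G" using F zero by (auto simp: G_def)
      then show "0 \<le> inner (snd z - snd z') (fst z - fst z')"
        if "z \<in> insert (0, 0) F" "z' \<in> insert (0, 0) F" for z z'
        using that by (intro mono) blast+
    qed (use F in auto)
    then obtain w where w: "\<forall>z\<in>insert (0, 0) F. 0 \<le> inner (snd z - K w) (fst z - w)"
      by auto
    then have "norm w \<le> R" by (intro coercive) simp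
    with w show "cball 0 R \<inter> (\<Inter>z\<in>F. S z) \<noteq> {}"
      by (auto simp: S_def)
  qed simp
  then obtain w where w: "\<And>z. z \<in> G \<Longrightarrow> w \<in> S z" by auto
  have "w \<in> \<gamma> (K w)"
  proof (rule maximal_monotone_mem [OF max])
    fix x q assume "q \<in> \<gamma> x"
    then have "w \<in> S (q, x)" by (intro w) (simp add: G_def)
    then show "0 \<le> inner (q - w) (x - K w)" by (simp add: S_def inner_commute)
  qed
  then show ?thesis by blast
qed

section \<open>Global inversion of proper injective maps\<close>

lemma proper_injective_homeomorphism:
  fixes J :: "'a::euclidean_space \<Rightarrow> 'a"
  assumes J: "continuous_on UNIV J" "inj J" and proper: "\<And>r. bounded {s. norm (J s) \<le> r}"
  obtains L where "homeomorphism UNIV UNIV J L"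
proof -
  have "open (range J)" using invariance_of_domain [of UNIV J] J by auto
  moreover have "closed (range J)"
  proof -
    have "w \<in> range J" if w: "w \<in> closure (range J)" for w
    proof -
      obtain \<rho> where "\<forall>s\<in>{s. norm (J s) \<le> norm w + 1}. norm s \<le> \<rho>"
        using proper [of "norm w + 1"] unfolding bounded_iff by blast
      then have \<rho>: "{s. norm (J s) \<le> norm w + 1} \<subseteq> cball 0 \<rho>" by auto
      have "compact (J ` cball 0 \<rho>)"
        using J by (intro compact_continuous_image) (auto intro: continuous_on_subset)
      moreover have "w \<in> closure (J ` cball 0 \<rho>)"
        unfolding closure_approachable
      proof (intro allI impI)
        fix e :: real assume "0 < e"
        then obtain y where y: "y \<in> range J" "dist y w < min e 1"
          using w unfolding closure_approachable by (metis min_less_iff_conj zero_less_one)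
        then obtain s where s: "y = J s" by blast
        have "norm (J s) \<le> norm w + 1"
          using y s norm_triangle_sub [of "J s" w] by (simp add: dist_norm)
        then have "s \<in> cball 0 \<rho>" using \<rho> by blast
        with y s show "\<exists>y\<in>J ` cball 0 \<rho>. dist y w < e" by auto
      qed
      ultimately show ?thesis using compact_imp_closed by fastforce
    qed
    then show ?thesis by (meson closure_subset_eq subsetI)
  qed
  ultimately have "range J = UNIV" using clopen [of "range J"] by auto
  then show ?thesis
    using invariance_of_domain_homeomorphism [of UNIV J] J that by auto
qed

section \<open>Gradients of convex functions and their inverses\<close>

lemma gradient_inequality:
  fixes f :: "'a::real_inner \<Rightarrow> real"
  assumes f: "convex_on S f" and x: "x \<in> S" "y \<in> S" and d: "GDERIV f x :> d"
  shows "inner d (y - x) \<le> f y - f x"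
proof -
  let ?g = "\<lambda>t. f (x + t *\<^sub>R (y - x))"
  have "((\<lambda>t. x + t *\<^sub>R (y - x)) has_derivative (\<lambda>t. t *\<^sub>R (y - x))) (at 0)"
    by (auto intro!: derivative_eq_intros)
  moreover have "(f has_derivative (\<lambda>h. inner h d)) (at (x + 0 *\<^sub>R (y - x)))"
    using d by (simp add: gderiv_def)
  ultimately have "(?g has_derivative (\<lambda>t. inner (t *\<^sub>R (y - x)) d)) (at 0)"
    using has_derivative_compose by blast
  then have "(?g has_real_derivative inner d (y - x)) (at 0)"
    by (simp add: has_field_derivative_def inner_commute mult.commute [of _ "inner d (y - x)"])
  then have "((\<lambda>t. (?g t - ?g 0) / t) \<longlongrightarrow> inner d (y - x)) (at 0)"
    by (simp add: DERIV_def)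
  then have lim: "((\<lambda>t. (?g t - f x) / t) \<longlongrightarrow> inner d (y - x)) (at_right 0)"
    by (auto intro: filterlim_mono at_le)
  have "\<forall>\<^sub>F t in at_right (0::real). t \<in> {0<..<1}"
    using eventually_at_right_real [of 0 "1::real"] by simp
  then have "\<forall>\<^sub>F t in at_right 0. (?g t - f x) / t \<le> f y - f x"
  proof eventually_elim
    case (elim t)
    then have t: "0 < t" "t < 1" by auto
    have "?g t = f ((1 - t) *\<^sub>R x + t *\<^sub>R y)" by (simp add: algebra_simps)
    also have "\<dots> \<le> (1 - t) * f x + t * f y"
      using t x by (intro convex_onD [OF f]) auto
    finally show ?case using t by (simp add: field_simps)
  qed
  then show ?thesis
    by (rule tendsto_upperbound [OF lim]) simp
qed

lemma strictly_convex_imp_convex_on: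
  assumes "strictly_convex_on S f" shows "convex_on S f"
proof (rule convex_onI)
  show "convex S" using assms by (simp add: strictly_convex_on_def)
  fix t x y assume t: "0 < (t::real)" "t < 1" and x: "x \<in> S" "y \<in> S"
  show "f ((1 - t) *\<^sub>R x + t *\<^sub>R y) \<le> (1 - t) * f x + t * f y"
  proof (cases "x = y")
    case True then show ?thesis by (simp add: algebra_simps)
  next
    case False
    with assms t x show ?thesis
      unfolding strictly_convex_on_def by (intro less_imp_le) (metis diff_add_cancel diff_gt_0_iff_gt)
  qed
qed

lemma gradient_monotone:
  fixes f :: "'a::real_inner \<Rightarrow> real"
  assumes f: "convex_on S f" and x: "x \<in> S" "y \<in> S"
    and d: "GDERIV f x :> d" "GDERIV f y :> e"
  shows "0 \<le> inner (d - e) (x - y)"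
  using gradient_inequality [OF f x d(1)] gradient_inequality [OF f x(2) x(1) d(2)]
  by (simp add: inner_diff_left inner_diff_right)

text \<open>
  Monotonicity is tested at \<open>\<psi> p\<close> and at the point of norm \<open>a / 2\<close> in the direction of \<open>p\<close>; on the
  ball of radius \<open>a / 2\<close> the map \<open>\<phi>\<close> is bounded.
\<close>
lemma inverse_coercive:
  fixes \<phi> \<psi> :: "'a::euclidean_space \<Rightarrow> 'a"
  assumes a: "0 < a" and hom: "homeomorphism (ball 0 a) UNIV \<phi> \<psi>"
    and mono: "\<And>x y. x \<in> ball 0 a \<Longrightarrow> y \<in> ball 0 a \<Longrightarrow> 0 \<le> inner (\<phi> x - \<phi> y) (x - y)"
  obtains C where "\<And>p. a / 2 * norm p - C \<le> inner (\<psi> p) p"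
proof -
  have "compact (\<phi> ` cball 0 (a / 2))"
    using a hom unfolding homeomorphism_def
    by (intro compact_continuous_image) (auto intro: continuous_on_subset)
  then obtain M where M: "\<And>y. y \<in> cball 0 (a / 2) \<Longrightarrow> norm (\<phi> y) \<le> M"
    using compact_imp_bounded bounded_iff by (metis imageI)
  have M0: "0 \<le> M" using order_trans [OF norm_ge_zero M [of 0]] a by simp
  have "a / 2 * norm p - M * (a + a / 2) \<le> inner (\<psi> p) p" for p
  proof -
    define y where "y = (a / 2) *\<^sub>R sgn p"
    have y: "norm y \<le> a / 2" using a by (simp add: y_def norm_sgn)
    have x: "\<psi> p \<in> ball 0 a" "\<phi> (\<psi> p) = p"
      using hom unfolding homeomorphism_def by auto
    have "0 \<le> inner (\<phi> (\<psi> p) - \<phi> y) (\<psi> p - y)"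
      using x y a by (intro mono) auto
    then have "inner p y + inner (\<phi> y) (\<psi> p - y) \<le> inner (\<psi> p) p"
      by (simp add: x inner_diff_left inner_diff_right inner_commute)
    moreover have "inner p y = a / 2 * norm p"
      by (cases "p = 0") (simp_all add: y_def sgn_div_norm power2_norm_eq_inner [symmetric] power2_eq_square)
    moreover have "\<bar>inner (\<phi> y) (\<psi> p - y)\<bar> \<le> M * (a + a / 2)"
    proof -
      have "norm (\<psi> p - y) \<le> a + a / 2"
        using x y norm_triangle_ineq4 [of "\<psi> p" y] by simp
      then have "norm (\<phi> y) * norm (\<psi> p - y) \<le> M * (a + a / 2)"
        using M y M0 by (intro mult_mono) auto
      then show ?thesis using Cauchy_Schwarz_ineq2 order_trans by blast
    qed
    ultimately show ?thesis by linarith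
  qed
  then show ?thesis using that by blast
qed

section \<open>The initial value problem and its boundary data\<close>

lemma inner_summation_by_parts:
  fixes p u :: "nat \<Rightarrow> 'a::real_inner"
  shows "inner (p T) (u (Suc T)) - inner (p 0) (u 0)
    = (\<Sum>n<T. inner (p (Suc n) - p n) (u (Suc n))) + (\<Sum>n\<le>T. inner (p n) (u (Suc n) - u n))"
  by (induction T) (auto simp: inner_diff_left inner_diff_right)

lemma inner_self_minus_ge:
  "- (norm h)\<^sup>2 / 4 \<le> inner (x - h) x" for x h :: "'a::real_inner"
proof -
  have "0 \<le> inner (x - (1/2) *\<^sub>R h) (x - (1/2) *\<^sub>R h)" by simp
  then show ?thesis
    by (simp add: inner_diff_left inner_diff_right inner_commute power2_norm_eq_inner)
qed

text \<open>
  The states \<open>(u n, p n)\<close> of the difference equation, \<open>p n\<close> being the flux between \<open>n\<close> and \<open>n + 1\<close>,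
  started in \<open>s = (u 0, p 0)\<close>. The recursion does not stop at \<open>T + 1\<close>; only \<open>u n\<close> with \<open>n \<le> T + 1\<close>
  and \<open>p n\<close> with \<open>n \<le> T\<close> belong to the boundary value problem.
\<close>
primrec flow :: "(nat \<Rightarrow> 'a) \<Rightarrow> ('a \<Rightarrow> 'a) \<Rightarrow> 'a \<times> 'a \<Rightarrow> nat \<Rightarrow> 'a \<times> ('a::real_normed_vector)" where
  "flow h \<psi> s 0 = s"
| "flow h \<psi> s (Suc n) =
    (let u = fst (flow h \<psi> s n) + \<psi> (snd (flow h \<psi> s n)) in (u, snd (flow h \<psi> s n) + u - h (Suc n)))"

lemma fst_flow_Suc: "fst (flow h \<psi> s (Suc n)) = fst (flow h \<psi> s n) + \<psi> (snd (flow h \<psi> s n))"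
  and snd_flow_Suc: "snd (flow h \<psi> s (Suc n)) = snd (flow h \<psi> s n) + fst (flow h \<psi> s (Suc n)) - h (Suc n)"
  by (simp_all add: Let_def)

lemma flow_start_determined:
  fixes h :: "nat \<Rightarrow> 'a::real_inner"
  assumes "fst (flow h \<psi> s (Suc 0)) = fst (flow h \<psi> s' (Suc 0))" "snd s = snd s'"
  shows "s = s'"
  using assms by (simp add: Let_def prod_eq_iff)

lemma continuous_on_flow:
  assumes "continuous_on UNIV \<psi>"
  shows "continuous_on UNIV (\<lambda>s. flow h \<psi> s n)"
proof (induction n)
  case (Suc n)
  show ?case
    unfolding flow.simps Let_def
    by (intro continuous_intros Suc continuous_on_compose2 [OF assms]) auto
qed simp

text \<open>
  The energy estimate behind all uniqueness statements. It is stated for arbitrary sequences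
  because it is applied both to flows and to solutions of the boundary value problem.
\<close>
lemma boundary_pairing_difference:
  fixes p u p' u' h :: "nat \<Rightarrow> 'a::real_inner"
  assumes "\<And>n. n < T \<Longrightarrow> p (Suc n) = p n + u (Suc n) - h (Suc n)"
    and "\<And>n. n < T \<Longrightarrow> p' (Suc n) = p' n + u' (Suc n) - h (Suc n)"
    and "\<And>n. n \<le> T \<Longrightarrow> 0 \<le> inner (p n - p' n) ((u (Suc n) - u n) - (u' (Suc n) - u' n))"
  shows "(\<Sum>n<T. (norm (u (Suc n) - u' (Suc n)))\<^sup>2)
    \<le> inner (p T - p' T) (u (Suc T) - u' (Suc T)) - inner (p 0 - p' 0) (u 0 - u' 0)"
proof -
  have "(\<Sum>n<T. (norm (u (Suc n) - u' (Suc n)))\<^sup>2)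
      = (\<Sum>n<T. inner ((p (Suc n) - p' (Suc n)) - (p n - p' n)) (u (Suc n) - u' (Suc n)))"
  proof (intro sum.cong refl)
    fix n assume "n \<in> {..<T}"
    then have "(p (Suc n) - p' (Suc n)) - (p n - p' n) = u (Suc n) - u' (Suc n)"
      using assms(1,2) by simp
    then show "(norm (u (Suc n) - u' (Suc n)))\<^sup>2
        = inner ((p (Suc n) - p' (Suc n)) - (p n - p' n)) (u (Suc n) - u' (Suc n))"
      by (simp add: power2_norm_eq_inner)
  qed
  moreover have "0 \<le> (\<Sum>n\<le>T. inner (p n - p' n) ((u (Suc n) - u' (Suc n)) - (u n - u' n)))"
    using assms(3) by (intro sum_nonneg) (auto simp: algebra_simps)
  ultimately show ?thesis
    using inner_summation_by_parts [of "\<lambda>n. p n - p' n" T "\<lambda>n. u n - u' n"] by linarith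
qed

lemma flow_boundary_pairing:
  fixes h :: "nat \<Rightarrow> 'a::real_inner" and \<psi> :: "'a \<Rightarrow> 'a"
  defines "u s n \<equiv> fst (flow h \<psi> s n)" and "p s n \<equiv> snd (flow h \<psi> s n)"
  shows "inner (p s T) (u s (Suc T)) - inner (p s 0) (u s 0)
    = (\<Sum>n<T. inner (u s (Suc n) - h (Suc n)) (u s (Suc n))) + (\<Sum>n\<le>T. inner (\<psi> (p s n)) (p s n))"
  unfolding u_def p_def
  by (subst inner_summation_by_parts [of "\<lambda>n. snd (flow h \<psi> s n)"])
    (simp add: fst_flow_Suc snd_flow_Suc inner_commute algebra_simps del: flow.simps(2))

text \<open>
  The fluxes at the two ends, with the orientation of the boundary condition.
\<close>
definition boundary_flux :: "nat \<Rightarrow> (nat \<Rightarrow> 'a) \<Rightarrow> ('a \<Rightarrow> 'a) \<Rightarrow> 'a \<times> 'a \<Rightarrow> 'a \<times> ('a::real_normed_vector)" where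
  "boundary_flux T h \<psi> s = (snd s, - snd (flow h \<psi> s T))"

text \<open>The values at the two ends \<open>0\<close> and \<open>T + 1\<close>.\<close>
definition boundary_value :: "nat \<Rightarrow> (nat \<Rightarrow> 'a) \<Rightarrow> ('a \<Rightarrow> 'a) \<Rightarrow> 'a \<times> 'a \<Rightarrow> 'a \<times> ('a::real_normed_vector)" where
  "boundary_value T h \<psi> s = (fst s, fst (flow h \<psi> s (Suc T)))"

lemma inj_boundary_flux:
  fixes h :: "nat \<Rightarrow> 'a::euclidean_space"
  assumes T: "1 \<le> T" and mono: "\<And>p q. 0 \<le> inner (p - q) (\<psi> p - \<psi> q)"
  shows "inj (boundary_flux T h \<psi>)"
proof (rule injI)
  fix s s' assume eq: "boundary_flux T h \<psi> s = boundary_flux T h \<psi> s'"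
  have "(\<Sum>n<T. (norm (fst (flow h \<psi> s (Suc n)) - fst (flow h \<psi> s' (Suc n))))\<^sup>2)
      \<le> inner (snd (flow h \<psi> s T) - snd (flow h \<psi> s' T))
          (fst (flow h \<psi> s (Suc T)) - fst (flow h \<psi> s' (Suc T)))
        - inner (snd (flow h \<psi> s 0) - snd (flow h \<psi> s' 0))
          (fst (flow h \<psi> s 0) - fst (flow h \<psi> s' 0))"
    by (rule boundary_pairing_difference [where h = h])
      (use mono in \<open>auto simp: fst_flow_Suc snd_flow_Suc simp del: flow.simps(2)\<close>)
  also have "\<dots> = 0" using eq by (simp add: boundary_flux_def)
  finally have "(\<Sum>n<T. (norm (fst (flow h \<psi> s (Suc n)) - fst (flow h \<psi> s' (Suc n))))\<^sup>2) = 0"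
    by (meson antisym sum_nonneg zero_le_power2)
  then have "fst (flow h \<psi> s (Suc 0)) = fst (flow h \<psi> s' (Suc 0))"
    using T by (subst (asm) sum_nonneg_eq_0_iff) (auto simp del: flow.simps)
  with eq show "s = s'" by (intro flow_start_determined) (auto simp: boundary_flux_def)
qed

text \<open>
  Given bounded boundary fluxes, the boundary pairing grows at most linearly in \<open>u 1\<close> and \<open>u T\<close>,
  whereas the interior terms grow quadratically in all \<open>u n\<close>. The assumption \<open>T \<ge> 2\<close> makes \<open>u 1\<close>
  and \<open>u T\<close> distinct terms of the interior sum.
\<close>
lemma bounded_boundary_flux_vimage:
  fixes h :: "nat \<Rightarrow> 'a::euclidean_space"
  assumes T: "2 \<le> T"
    and bound: "\<And>p. norm (\<psi> p) \<le> a" and pos: "\<And>p. 0 \<le> inner (\<psi> p) p"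
  shows "bounded {s. norm (boundary_flux T h \<psi> s) \<le> r}"
proof (cases "0 \<le> r")
  case False
  then have "{s. norm (boundary_flux T h \<psi> s) \<le> r} = {}"
    by (smt (verit) Collect_empty_eq norm_ge_zero)
  then show ?thesis by (simp only: bounded_empty)
next
  case r: True
  define b where "b = (\<Sum>n<T. (norm (h (Suc n)) + (r + 1))\<^sup>2 / 4) + 2 * r * a"
  have a: "0 \<le> a" using bound [of 0] norm_ge_zero order_trans by blast
  have "norm s \<le> b + a + r" if s: "norm (boundary_flux T h \<psi> s) \<le> r" for s
  proof -
    define u where "u n = fst (flow h \<psi> s n)" for n
    define p where "p n = snd (flow h \<psi> s n)" for n
    have p0: "norm (p 0) \<le> r" and pT: "norm (p T) \<le> r"
      using s order_trans [OF norm_fst_le [of "snd s" "- snd (flow h \<psi> s T)"]]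
        order_trans [OF norm_snd_le [of "- snd (flow h \<psi> s T)" "snd s"]]
      by (auto simp: boundary_flux_def p_def)
    have step: "u (Suc n) = u n + \<psi> (p n)" for n
      unfolding u_def p_def by (rule fst_flow_Suc)
    have u0: "norm (u 0) \<le> norm (u 1) + a"
      using step [of 0] norm_triangle_ineq4 [of "u 1" "\<psi> (p 0)"] bound [of "p 0"] by simp
    have uT: "norm (u (Suc T)) \<le> norm (u T) + a"
      using step [of T] norm_triangle_ineq [of "u T" "\<psi> (p T)"] bound [of "p T"] by simp
    have "inner (p T) (u (Suc T)) \<le> r * (norm (u T) + a)"
      using norm_cauchy_schwarz [of "p T" "u (Suc T)"]
        mult_mono [OF pT uT r norm_ge_zero] by linarith
    moreover have "- inner (p 0) (u 0) \<le> r * (norm (u 1) + a)"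
      using norm_cauchy_schwarz [of "- p 0" "u 0"] mult_mono [OF p0 u0 r norm_ge_zero] by simp
    moreover have "norm (u 1) + norm (u T) \<le> (\<Sum>n<T. norm (u (Suc n)))"
    proof -
      have "(\<Sum>n\<in>{0, T - 1}. norm (u (Suc n))) \<le> (\<Sum>n<T. norm (u (Suc n)))"
        using T by (intro sum_mono2) auto
      then show ?thesis using T by simp
    qed
    then have "r * (norm (u 1) + norm (u T)) \<le> r * (\<Sum>n<T. norm (u (Suc n)))"
      using r by (rule mult_left_mono)
    ultimately have up: "inner (p T) (u (Suc T)) - inner (p 0) (u 0)
        \<le> (\<Sum>n<T. r * norm (u (Suc n))) + 2 * r * a"
      by (simp add: sum_distrib_left algebra_simps)
    \<comment> \<open>the excess of \<open>r + 1\<close> over \<open>r\<close> leaves \<open>norm v\<close> after absorbing the linear boundary terms\<close>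
    have "norm v + r * norm v - (norm g + (r + 1))\<^sup>2 / 4 \<le> inner (v - g) v" for v g :: 'a
    proof -
      have "inner g v \<le> norm g * norm v" by (rule norm_cauchy_schwarz)
      moreover have "0 \<le> (norm v - (norm g + (r + 1)) / 2)\<^sup>2" by simp
      ultimately show ?thesis
        by (simp add: inner_diff_left power2_norm_eq_inner [symmetric] power2_eq_square field_simps)
    qed
    then have "(\<Sum>n<T. norm (u (Suc n)) + r * norm (u (Suc n)) - (norm (h (Suc n)) + (r + 1))\<^sup>2 / 4)
        \<le> (\<Sum>n<T. inner (u (Suc n) - h (Suc n)) (u (Suc n)))"
      by (intro sum_mono)
    also have "\<dots> \<le> inner (p T) (u (Suc T)) - inner (p 0) (u 0)"
      using flow_boundary_pairing [of h \<psi> s T] sum_nonneg [of "{..T}" "\<lambda>n. inner (\<psi> (p n)) (p n)"] pos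
      by (simp add: u_def p_def del: flow.simps)
    finally have "(\<Sum>n<T. norm (u (Suc n))) \<le> b"
      using up by (simp add: b_def sum.distrib sum_subtractf)
    moreover have "norm (u (Suc 0)) \<le> (\<Sum>n<T. norm (u (Suc n)))"
      using T by (intro member_le_sum) auto
    ultimately have "norm (u 0) \<le> b + a" using u0 by simp
    then have "norm (fst s) + norm (snd s) \<le> b + a + r"
      using p0 by (simp add: u_def p_def)
    then show ?thesis
      using norm_Pair_le [of "fst s" "snd s"] by simp
  qed
  then show ?thesis by (auto simp: bounded_iff)
qed

text \<open>
  Here the two end fluxes are controlled by the linear growth of \<open>\<langle>\<psi> p, p\<rangle>\<close>, while the terms with
  \<open>u n\<close> are only bounded from below.
\<close>
lemma boundary_flux_coercive:
  fixes h :: "nat \<Rightarrow> 'a::euclidean_space"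
  assumes T: "1 \<le> T" and a: "0 < a" and C: "\<And>p. a / 2 * norm p - C \<le> inner (\<psi> p) p"
  obtains R where
    "\<And>s. 0 \<le> inner (boundary_value T h \<psi> s) (boundary_flux T h \<psi> s) \<Longrightarrow> norm (boundary_flux T h \<psi> s) \<le> R"
proof -
  define b where "b = (\<Sum>n<T. (norm (h (Suc n)))\<^sup>2 / 4) + (\<Sum>n\<le>T. C)"
  have "norm (boundary_flux T h \<psi> s) \<le> 2 * b / a"
    if nonneg: "0 \<le> inner (boundary_value T h \<psi> s) (boundary_flux T h \<psi> s)" for s
  proof -
    define p where "p n = snd (flow h \<psi> s n)" for n
    have "(\<Sum>n<T. - (norm (h (Suc n)))\<^sup>2 / 4) + (\<Sum>n\<le>T. a / 2 * norm (p n) - C)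
        \<le> (\<Sum>n<T. inner (fst (flow h \<psi> s (Suc n)) - h (Suc n)) (fst (flow h \<psi> s (Suc n))))
          + (\<Sum>n\<le>T. inner (\<psi> (p n)) (p n))"
      by (intro add_mono sum_mono inner_self_minus_ge C)
    also have "\<dots> = - inner (boundary_value T h \<psi> s) (boundary_flux T h \<psi> s)"
      using flow_boundary_pairing [of h \<psi> s T]
      by (simp add: p_def boundary_value_def boundary_flux_def inner_prod_def inner_commute
          del: flow.simps(2))
    finally have "a / 2 * (\<Sum>n\<le>T. norm (p n)) \<le> b"
      using nonneg by (simp add: b_def sum_subtractf sum_distrib_left sum_negf)
    moreover have "norm (p 0) + norm (p T) \<le> (\<Sum>n\<le>T. norm (p n))"
    proof -
      have "(\<Sum>n\<in>{0, T}. norm (p n)) \<le> (\<Sum>n\<le>T. norm (p n))"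
        by (intro sum_mono2) auto
      then show ?thesis using T by simp
    qed
    moreover have "norm (boundary_flux T h \<psi> s) \<le> norm (p 0) + norm (p T)"
      using norm_Pair_le [of "p 0" "- p T"] by (simp add: boundary_flux_def p_def)
    ultimately have "a / 2 * norm (boundary_flux T h \<psi> s) \<le> b"
      using a by (smt (verit, best) mult_left_mono half_gt_zero_iff)
    then show ?thesis using a by (simp add: field_simps)
  qed
  then show ?thesis using that by blast
qed

lemma flow_solves_inclusion:
  fixes h :: "nat \<Rightarrow> 'a::euclidean_space"
  assumes T: "2 \<le> T" and a: "0 < a" and cont: "continuous_on UNIV \<psi>"
    and mono: "\<And>p q. 0 \<le> inner (p - q) (\<psi> p - \<psi> q)"
    and zero: "\<psi> 0 = 0" and bound: "\<And>p. norm (\<psi> p) \<le> a"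
    and C: "\<And>p. a / 2 * norm p - C \<le> inner (\<psi> p) p"
    and \<gamma>: "maximal_monotone \<gamma>" "(0, 0) \<in> \<gamma> (0, 0)"
  shows "\<exists>s. boundary_flux T h \<psi> s \<in> \<gamma> (boundary_value T h \<psi> s)"
proof -
  have pos: "0 \<le> inner (\<psi> p) p" for p
    using mono [of p 0] by (simp add: zero inner_commute)
  have contJ: "continuous_on UNIV (boundary_flux T h \<psi>)"
    unfolding boundary_flux_def by (intro continuous_intros continuous_on_flow cont)
  have contV: "continuous_on UNIV (boundary_value T h \<psi>)"
    unfolding boundary_value_def by (intro continuous_intros continuous_on_flow cont)
  obtain L where L: "homeomorphism UNIV UNIV (boundary_flux T h \<psi>) L"
  proof (rule proper_injective_homeomorphism [OF contJ])
    show "inj (boundary_flux T h \<psi>)" using T mono by (intro inj_boundary_flux) auto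
    show "bounded {s. norm (boundary_flux T h \<psi> s) \<le> r}" for r
      using T bound pos by (rule bounded_boundary_flux_vimage)
  qed
  obtain R where R: "\<And>s. 0 \<le> inner (boundary_value T h \<psi> s) (boundary_flux T h \<psi> s)
      \<Longrightarrow> norm (boundary_flux T h \<psi> s) \<le> R"
    using boundary_flux_coercive [OF _ a C] T by (metis le_trans one_le_numeral)
  have JL: "boundary_flux T h \<psi> (L w) = w" for w
    using L unfolding homeomorphism_def by blast
  have "\<exists>w. w \<in> \<gamma> (boundary_value T h \<psi> (L w))"
  proof (rule maximal_monotone_inclusion_solvable)
    show "continuous_on UNIV (\<lambda>w. boundary_value T h \<psi> (L w))"
      using L by (intro continuous_on_compose2 [OF contV]) (auto simp: homeomorphism_def)
    show "norm w \<le> R" if "0 \<le> inner (boundary_value T h \<psi> (L w)) w" for w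
      using R [of "L w"] that by (simp add: JL)
  qed (use \<gamma> in \<open>auto simp: zero_prod_def\<close>)
  then show ?thesis by (metis JL)
qed

section \<open>The boundary value problem\<close>

lemma is_solution_unique:
  fixes u v h :: "nat \<Rightarrow> 'a::real_inner"
  assumes T: "2 \<le> T" and inj: "inj_on \<phi> (ball 0 a)"
    and mono: "\<And>x y. x \<in> ball 0 a \<Longrightarrow> y \<in> ball 0 a \<Longrightarrow> 0 \<le> inner (\<phi> x - \<phi> y) (x - y)"
    and \<gamma>: "monotone_operator \<gamma>"
    and u: "is_solution a \<phi> \<gamma> T h u" and v: "is_solution a \<phi> \<gamma> T h v"
    and n: "n \<le> T + 1"
  shows "u n = v n"
proof -
  have ball: "fwd_diff w n \<in> ball 0 a" if "is_solution a \<phi> \<gamma> T h w" "n \<le> T" for w n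
  proof -
    have "norm (fwd_diff w (Suc n - 1)) \<le> fwd_diff_sup_norm T w"
      unfolding fwd_diff_sup_norm_def using that by (intro Max_ge imageI finite_imageI) auto
    with that show ?thesis by (simp add: is_solution_def)
  qed
  have eq: "\<phi> (fwd_diff w (Suc n)) = \<phi> (fwd_diff w n) + w (Suc n) - h (Suc n)"
    if "is_solution a \<phi> \<gamma> T h w" "n < T" for w n
  proof -
    have "- fwd_diff (\<lambda>k. \<phi> (fwd_diff w k)) (Suc n - 1) + w (Suc n) = h (Suc n)"
      using that unfolding is_solution_def by (metis Suc_leI atLeastAtMost_iff le_add1 plus_1_eq_Suc)
    then show ?thesis by (simp add: fwd_diff_def [of "\<lambda>k. \<phi> (fwd_diff w k)"] algebra_simps)
  qed
  have "(\<Sum>n<T. (norm (u (Suc n) - v (Suc n)))\<^sup>2)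
      \<le> inner (\<phi> (fwd_diff u T) - \<phi> (fwd_diff v T)) (u (Suc T) - v (Suc T))
        - inner (\<phi> (fwd_diff u 0) - \<phi> (fwd_diff v 0)) (u 0 - v 0)"
  proof (rule boundary_pairing_difference [where h = h])
    fix n assume "n \<le> T"
    then have "0 \<le> inner (\<phi> (fwd_diff u n) - \<phi> (fwd_diff v n)) (fwd_diff u n - fwd_diff v n)"
      using u v by (intro mono ball)
    then show "0 \<le> inner (\<phi> (fwd_diff u n) - \<phi> (fwd_diff v n)) (u (Suc n) - u n - (v (Suc n) - v n))"
      by (simp add: fwd_diff_def)
  qed (use u v eq in auto)
  also have "\<dots> = - inner ((\<phi> (fwd_diff u 0), - \<phi> (fwd_diff u T)) - (\<phi> (fwd_diff v 0), - \<phi> (fwd_diff v T)))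
      ((u 0, u (T + 1)) - (v 0, v (T + 1)))"
    by (simp add: inner_prod_def inner_diff_left inner_diff_right)
  also have "\<dots> \<le> 0"
  proof -
    have "(\<phi> (fwd_diff u 0), - \<phi> (fwd_diff u T)) \<in> \<gamma> (u 0, u (T + 1))"
      "(\<phi> (fwd_diff v 0), - \<phi> (fwd_diff v T)) \<in> \<gamma> (v 0, v (T + 1))"
      using u v by (simp_all only: is_solution_def)
    with \<gamma> show ?thesis unfolding monotone_operator_def neg_le_0_iff_le by blast
  qed
  finally have "(\<Sum>n<T. (norm (u (Suc n) - v (Suc n)))\<^sup>2) = 0"
    by (meson antisym sum_nonneg zero_le_power2)
  then have int: "u (Suc n) = v (Suc n)" if "n < T" for n
    using that by (subst (asm) sum_nonneg_eq_0_iff) auto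
  \<comment> \<open>\<open>T \<ge> 2\<close> gives the two interior points \<open>1\<close> and \<open>2\<close>, hence the flux between them\<close>
  have "fwd_diff u 1 = fwd_diff v 1"
    using int [of 0] int [of 1] T by (simp add: fwd_diff_def numeral_2_eq_2)
  then have "\<phi> (fwd_diff u n) = \<phi> (fwd_diff v n)" if "n \<le> T" for n
    using that
  proof (induction n)
    case 0
    then show ?case using eq [OF u, of 0] eq [OF v, of 0] int [of 0] T by simp
  next
    case (Suc n)
    then show ?case using eq [OF u, of n] eq [OF v, of n] int [of n] by simp
  qed
  then have diff: "fwd_diff u n = fwd_diff v n" if "n \<le> T" for n
    using that inj_onD [OF inj _ ball [OF u] ball [OF v]] by blast
  have "u 0 = v 0"
    using diff [of 0] int [of 0] T by (simp add: fwd_diff_def)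
  then have "n \<le> T + 1 \<Longrightarrow> u n = v n" for n
  proof (induction n)
    case (Suc n)
    then show ?case using diff [of n] by (simp add: fwd_diff_def)
  qed simp
  then show ?thesis using n by blast
qed

lemma is_solution_flow:
  fixes h :: "nat \<Rightarrow> 'a::real_inner"
  assumes \<psi>: "\<And>p. norm (\<psi> p) < a" "\<And>p. \<phi> (\<psi> p) = p"
    and s: "boundary_flux T h \<psi> s \<in> \<gamma> (boundary_value T h \<psi> s)"
    and u: "\<And>n. n \<le> T + 1 \<Longrightarrow> u n = fst (flow h \<psi> s n)"
  shows "is_solution a \<phi> \<gamma> T h u"
proof -
  have diff: "fwd_diff u n = \<psi> (snd (flow h \<psi> s n))" if "n \<le> T" for n
    using that by (simp add: fwd_diff_def u fst_flow_Suc del: flow.simps(2))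
  have "fwd_diff_sup_norm T u < a"
    unfolding fwd_diff_sup_norm_def using \<psi> by (subst Max_less_iff) (auto simp: diff)
  moreover have bc: "(\<phi> (fwd_diff u 0), - \<phi> (fwd_diff u T)) \<in> \<gamma> (u 0, u (T + 1))"
    using s by (simp add: diff \<psi> u boundary_flux_def boundary_value_def del: flow.simps(2))
  moreover have "- fwd_diff (\<lambda>k. \<phi> (fwd_diff u k)) (n - 1) + u n = h n" if n: "n \<in> {1..T}" for n
  proof -
    obtain m where m: "n = Suc m" using n by (cases n) auto
    with n have "\<phi> (fwd_diff u n) = snd (flow h \<psi> s n)" "\<phi> (fwd_diff u m) = snd (flow h \<psi> s m)"
      by (simp_all add: diff \<psi> del: flow.simps(2))
    then show ?thesis
      using n m by (simp add: fwd_diff_def [of "\<lambda>k. \<phi> (fwd_diff u k)"] u snd_flow_Suc del: flow.simps(2))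
  qed
  ultimately show ?thesis by (auto simp: is_solution_def op_domain_def)
qed

theorem theorem2p1:
  fixes a :: real
    and T :: nat
    and \<phi> :: "real ^ 'n \<Rightarrow> real ^ 'n"
    and \<Phi> :: "real ^ 'n \<Rightarrow> real"
    and \<gamma> :: "(real ^ 'n) \<times> (real ^ 'n) \<Rightarrow> ((real ^ 'n) \<times> (real ^ 'n)) set"
    and h :: "nat \<Rightarrow> real ^ 'n"
  assumes "0 < a"
    and "2 \<le> T"
    and "\<exists>\<psi>. homeomorphism (ball 0 a) UNIV \<phi> \<psi>"
    and "\<phi> 0 = 0"
    and "C1_on (ball 0 a) \<Phi>"
    and "\<And>x. x \<in> ball 0 a \<Longrightarrow> GDERIV \<Phi> x :> \<phi> x"
    and "continuous_on (cball 0 a) \<Phi>"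
    and "strictly_convex_on (cball 0 a) \<Phi>"
    and "\<Phi> 0 = 0"
    and "maximal_monotone \<gamma>"
    and "(0, 0) \<in> \<gamma> (0, 0)"
  shows "\<exists>!u. u \<in> {0..T+1} \<rightarrow>\<^sub>E UNIV \<and> is_solution a \<phi> \<gamma> T h u"
proof -
  note a = assms(1) and T = assms(2)
  obtain \<psi> where hom: "homeomorphism (ball 0 a) UNIV \<phi> \<psi>" using assms(3) by blast
  have mono: "0 \<le> inner (\<phi> x - \<phi> y) (x - y)" if "x \<in> ball 0 a" "y \<in> ball 0 a" for x y
    using that assms(6) strictly_convex_imp_convex_on [OF assms(8)]
    by (intro gradient_monotone [of "cball 0 a" \<Phi>]) auto
  have \<psi>: "\<psi> p \<in> ball 0 a" "\<phi> (\<psi> p) = p" for p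
    using hom unfolding homeomorphism_def by auto
  have bound: "norm (\<psi> p) < a" for p using \<psi>(1) [of p] by simp
  obtain C where C: "\<And>p. a / 2 * norm p - C \<le> inner (\<psi> p) p"
    using inverse_coercive [OF a hom mono] by blast
  have "\<exists>s. boundary_flux T h \<psi> s \<in> \<gamma> (boundary_value T h \<psi> s)"
  proof (rule flow_solves_inclusion [OF T a])
    show "continuous_on UNIV \<psi>" using hom by (simp add: homeomorphism_def)
    show "0 \<le> inner (p - q) (\<psi> p - \<psi> q)" for p q
      using mono [OF \<psi>(1) \<psi>(1), of p q] by (simp add: \<psi>(2))
    show "\<psi> 0 = 0" using hom a assms(4) unfolding homeomorphism_def by (metis centre_in_ball)
    show "norm (\<psi> p) \<le> a" for p using bound by (simp add: less_imp_le)
  qed (use C assms(10,11) in auto)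
  then obtain s where s: "boundary_flux T h \<psi> s \<in> \<gamma> (boundary_value T h \<psi> s)" by blast
  show ?thesis
  proof (rule ex1I)
    let ?u = "restrict (\<lambda>n. fst (flow h \<psi> s n)) {0..T+1}"
    have "is_solution a \<phi> \<gamma> T h ?u"
      by (rule is_solution_flow [where \<psi> = \<psi> and s = s]) (use bound \<psi>(2) s in auto)
    then show ex: "?u \<in> {0..T+1} \<rightarrow>\<^sub>E UNIV \<and> is_solution a \<phi> \<gamma> T h ?u" by simp
    fix v assume v: "v \<in> {0..T+1} \<rightarrow>\<^sub>E UNIV \<and> is_solution a \<phi> \<gamma> T h v"
    show "v = ?u"
    proof (rule PiE_ext)
      fix n assume "n \<in> {0..T+1}"
      then have n: "n \<le> T + 1" by simp
      have inj: "inj_on \<phi> (ball 0 a)"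
        using hom unfolding homeomorphism_def by (metis inj_on_inverseI)
      have "monotone_operator \<gamma>" using assms(10) by (simp add: maximal_monotone_def)
      with v ex n show "v n = ?u n"
        by (blast intro: is_solution_unique [OF T inj mono])
    qed (use v ex in auto)
  qed
qed

end
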